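(* There exists a two-dimensional cellular automaton $\mathcal{A}=(2,Q,\mathcal{N}_{vN},\delta)$ with $\{0,1\}\subseteq Q$, working on the von Neumann neighborhood $\mathcal{N}_{vN}=\{c\in\mathbb{Z}^2 : \|c\|_1\le 1\}$, together with a quiescent state $q_0\in Q\setminus\{0,1\}$ and a set of accepting states $Q_a\subseteq Q$, that recognizes the picture language $L_{\text{L-convex}}$ in real time. That is, for all $n,m$ and every $(n,m)$-picture $p$ over $\{0,1\}$, $$\mathcal{A}^{\,n+m-2}(\mathcal{C}_{p,q_0})(0,0)\in Q_a \iff p\in L_{\text{L-convex}}.$$
   Context: A 2D cellular automaton $(2,Q,\mathcal{N},\delta)$ consists of a finite state set $Q$, a finite neighborhood $\mathcal{N}\subset\mathbb{Z}^2$, and a local rule $\delta:Q^{\mathcal{N}}\to Q$. A configuration is a map $\mathcal{C}:\mathbb{Z}^2\to Q$. The global map is $\mathcal{A}(\mathcal{C})(c)=\delta(n\mapsto \mathcal{C}(c+n))$, and $\mathcal{A}^t$ denotes its $t$-fold iterate. An $(n,m)$-picture over an alphabet $\Sigma$ is a map $p:\{0,\dots,n-1\}\times\{0,\dots,m-1\}\to\Sigma$, so $n$ is the width and $m$ the height. Its picture configuration $\mathcal{C}_{p,q_0}$ is defined by $\mathcal{C}_{p,q_0}(x,y)=p(x,y)$ when $(x,y)$ lies in the picture's domain, and $q_0$ otherwise. In particular the origin $(0,0)$ is the lower-left cell of the picture. For the von Neumann neighborhood, the real time function is $\tau(n,m)=n+m-2$. A (placed) polyomino is a finite 4-connected subset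 of $\mathbb{Z}^2$, considered up to translation. - It is HV-convex if, whenever two of its cells lie on the same row (respectively column), every cell between them on that row (respectively column) also belongs to it. - It is L-convex if it is HV-convex and, for all $(x_1,y_1),(x_2,y_2)$ in the polyomino, at least one of $(x_1,y_2)$ or $(x_2,y_1)$ is in the polyomino. Equivalently, any two of its cells are joined by an inner 4-connected path that changes direction at most once. The picture associated with a polyomino is the picture over $\{0,1\}$ whose dimensions are those of the polyomino's minimal bounding rectangle. A cell has value $1$ if the corresponding cell belongs to the polyomino and $0$ otherwise. $L_{\text{L-convex}}$ is the set of all pictures associated with L-convex polyominoes. *)

theory Defs
  imports Main
begin

type_synonym cell = "int \<times> int"

text \<open>Global map of a 2D cellular automaton with neighborhood N and local rule delta.
  The local rule receives the neighborhood restricted to N (values outside N are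
  a fixed dummy, so delta can only depend on the cells of the neighborhood).\<close>
definition ca_global :: "cell set \<Rightarrow> ((cell \<Rightarrow> 'q) \<Rightarrow> 'q) \<Rightarrow> (cell \<Rightarrow> 'q) \<Rightarrow> (cell \<Rightarrow> 'q)" where
  "ca_global N \<delta> C c = \<delta> (\<lambda>d. if d \<in> N then C (fst c + fst d, snd c + snd d) else undefined)"

definition vonNeumann :: "cell set" where
  "vonNeumann = {c. \<bar>fst c\<bar> + \<bar>snd c\<bar> \<le> 1}"

definition pic_config :: "nat \<Rightarrow> nat \<Rightarrow> (nat \<Rightarrow> nat \<Rightarrow> 'q) \<Rightarrow> 'q \<Rightarrow> cell \<Rightarrow> 'q" where
  "pic_config n m p q0 c =
     (if 0 \<le> fst c \<and> fst c < int n \<and> 0 \<le> snd c \<and> snd c < int m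
      then p (nat (fst c)) (nat (snd c)) else q0)"

definition adj4 :: "cell \<Rightarrow> cell \<Rightarrow> bool" where
  "adj4 a b \<longleftrightarrow> \<bar>fst a - fst b\<bar> + \<bar>snd a - snd b\<bar> = 1"

definition connected4 :: "cell set \<Rightarrow> bool" where
  "connected4 P \<longleftrightarrow> (\<forall>a\<in>P. \<forall>b\<in>P. (\<lambda>x y. x \<in> P \<and> y \<in> P \<and> adj4 x y)\<^sup>*\<^sup>* a b)"

definition polyomino :: "cell set \<Rightarrow> bool" where
  "polyomino P \<longleftrightarrow> finite P \<and> P \<noteq> {} \<and> connected4 P"

definition hv_convex :: "cell set \<Rightarrow> bool" where
  "hv_convex P \<longleftrightarrow>
     (\<forall>x1 x2 x y. (x1, y) \<in> P \<longrightarrow> (x2, y) \<in> P \<longrightarrow> x1 \<le> x \<longrightarrow> x \<le> x2 \<longrightarrow> (x, y) \<in> P) \<and>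
     (\<forall>x y1 y2 y. (x, y1) \<in> P \<longrightarrow> (x, y2) \<in> P \<longrightarrow> y1 \<le> y \<longrightarrow> y \<le> y2 \<longrightarrow> (x, y) \<in> P)"

definition l_convex :: "cell set \<Rightarrow> bool" where
  "l_convex P \<longleftrightarrow> hv_convex P \<and>
     (\<forall>x1 y1 x2 y2. (x1, y1) \<in> P \<longrightarrow> (x2, y2) \<in> P \<longrightarrow> (x1, y2) \<in> P \<or> (x2, y1) \<in> P)"

definition assoc_picture :: "cell set \<Rightarrow> nat \<Rightarrow> nat \<Rightarrow> (nat \<Rightarrow> nat \<Rightarrow> nat) \<Rightarrow> bool" where
  "assoc_picture P n m p \<longleftrightarrow>
     (let x0 = Min (fst ` P); x1 = Max (fst ` P); y0 = Min (snd ` P); y1 = Max (snd ` P) in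
       int n = x1 - x0 + 1 \<and> int m = y1 - y0 + 1 \<and>
       (\<forall>x<n. \<forall>y<m. p x y = (if (x0 + int x, y0 + int y) \<in> P then 1 else 0)))"

definition L_Lconvex :: "nat \<Rightarrow> nat \<Rightarrow> (nat \<Rightarrow> nat \<Rightarrow> nat) \<Rightarrow> bool" where
  "L_Lconvex n m p \<longleftrightarrow> (\<exists>P. polyomino P \<and> l_convex P \<and> assoc_picture P n m p)"

end

theory Submission
  imports Defs
begin

text \<open>
  A picture is in the language iff its rows and columns are intervals, no row is empty, some row is
  full, and no two rows \<open>u > v\<close> and columns \<open>x < X\<close> carry the pattern 10/01 or 01/10. Because of the
  full row, the last condition only has to be tested for two pairs of rows per column \<open>x\<close>: if the
  ones of the column fill the rows \<open>c..d\<close>, these are \<open>(d, c - 1)\<close> and \<open>(d + 1, c)\<close>. For this test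
  every row is shifted to the left at speed 1, and at \<open>x\<close> the two rows in question are redirected
  along the column towards each other. At the midpoint between \<open>u\<close> and \<open>v\<close> the entries of the two
  rows in the same column \<open>X\<close> arrive simultaneously. A difference found there reaches the origin at
  time \<open>X + u \<le> (n - 1) + (m - 1)\<close>, hence in real time.
\<close>

section \<open>L-convex pictures\<close>

definition inside :: "int \<Rightarrow> int \<Rightarrow> int \<Rightarrow> int \<Rightarrow> bool" where
  "inside n m x y \<longleftrightarrow> 0 \<le> x \<and> x < n \<and> 0 \<le> y \<and> y < m"

lemma hv_convex_row:
  "hv_convex P \<Longrightarrow> (x1, y) \<in> P \<Longrightarrow> (x2, y) \<in> P \<Longrightarrow> x1 \<le> x \<Longrightarrow> x \<le> x2 \<Longrightarrow> (x, y) \<in> P"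
  unfolding hv_convex_def by blast

lemma hv_convex_column:
  "hv_convex P \<Longrightarrow> (x, y1) \<in> P \<Longrightarrow> (x, y2) \<in> P \<Longrightarrow> y1 \<le> y \<Longrightarrow> y \<le> y2 \<Longrightarrow> (x, y) \<in> P"
  unfolding hv_convex_def by blast

lemma l_convex_corner:
  "l_convex P \<Longrightarrow> (x1, y1) \<in> P \<Longrightarrow> (x2, y2) \<in> P \<Longrightarrow> (x1, y2) \<in> P \<or> (x2, y1) \<in> P"
  unfolding l_convex_def by blast

text \<open>Walk from one cell to whichever corner lies in \<open>P\<close>, then turn towards the
  other cell; convexity keeps both legs inside \<open>P\<close>. This is why the automaton contains
  no connectivity test.\<close>

lemma l_convex_imp_connected4:
  assumes "l_convex P"
  shows "connected4 P"
proof -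
  define R where "R = (\<lambda>x y. x \<in> P \<and> y \<in> P \<and> adj4 x y)"
  have hv: "hv_convex P" using assms by (simp add: l_convex_def)
  have "symp R" by (auto simp: symp_def R_def adj4_def)
  hence sym: "R\<^sup>*\<^sup>* b a" if "R\<^sup>*\<^sup>* a b" for a b
    using that by (meson symp_rtranclp sympD)
  have row: "R\<^sup>*\<^sup>* (x, y) (x + int k, y)" if "(x, y) \<in> P" "(x + int k, y) \<in> P" for x y k
    using that
  proof (induction k)
    case (Suc k)
    have mem: "(x + int k, y) \<in> P"
      by (rule hv_convex_row[OF hv Suc.prems]) auto
    have "R (x + int k, y) (x + int (Suc k), y)"
      using mem Suc.prems by (auto simp: R_def adj4_def)
    with Suc.IH[OF Suc.prems(1) mem] show ?case by (rule rtranclp.rtrancl_into_rtrancl)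
  qed simp
  have col: "R\<^sup>*\<^sup>* (x, y) (x, y + int k)" if "(x, y) \<in> P" "(x, y + int k) \<in> P" for x y k
    using that
  proof (induction k)
    case (Suc k)
    have mem: "(x, y + int k) \<in> P"
      by (rule hv_convex_column[OF hv Suc.prems]) auto
    have "R (x, y + int k) (x, y + int (Suc k))"
      using mem Suc.prems by (auto simp: R_def adj4_def)
    with Suc.IH[OF Suc.prems(1) mem] show ?case by (rule rtranclp.rtrancl_into_rtrancl)
  qed simp
  have row': "R\<^sup>*\<^sup>* (x, y) (x', y)" if "(x, y) \<in> P" "(x', y) \<in> P" for x x' y
    using row[of x y "nat (x' - x)"] row[of x' y "nat (x - x')"] that sym
    by (cases "x \<le> x'") auto
  have col': "R\<^sup>*\<^sup>* (x, y) (x, y')" if "(x, y) \<in> P" "(x, y') \<in> P" for x y y'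
    using col[of x y "nat (y' - y)"] col[of x y' "nat (y - y')"] that sym
    by (cases "y \<le> y'") auto
  have "R\<^sup>*\<^sup>* (x1, y1) (x2, y2)" if "(x1, y1) \<in> P" "(x2, y2) \<in> P" for x1 y1 x2 y2
    using l_convex_corner[OF assms that]
  proof
    assume "(x1, y2) \<in> P"
    with that show ?thesis using col'[of x1 y1 y2] row'[of x1 y2 x2] by auto
  next
    assume "(x2, y1) \<in> P"
    with that show ?thesis using row'[of x1 y1 x2] col'[of x2 y1 y2] by auto
  qed
  thus ?thesis unfolding connected4_def R_def by auto
qed

text \<open>The entries are extended by False to the whole plane, so rows and columns just beyond
  the border can be used as zeros.\<close>

locale picture =
  fixes n m :: int and w :: "int \<Rightarrow> int \<Rightarrow> bool"
  assumes w_inside: "w x y \<Longrightarrow> inside n m x y"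
begin

definition ones :: "cell set" where "ones = {(x, y). w x y}"

definition full_row :: bool where
  "full_row \<longleftrightarrow> (\<exists>y. 0 \<le> y \<and> y < m \<and> (\<forall>x. 0 \<le> x \<and> x < n \<longrightarrow> w x y))"

definition rows_nonempty :: bool where
  "rows_nonempty \<longleftrightarrow> (\<forall>y. 0 \<le> y \<and> y < m \<longrightarrow> (\<exists>x. w x y))"

lemma in_ones [simp]: "(x, y) \<in> ones \<longleftrightarrow> w x y"
  by (simp add: ones_def)

end

lemma bounding_box_min_max:
  assumes "finite P" "(x, y) \<in> P"
  shows "Min (fst ` P) \<le> x" "x \<le> Max (fst ` P)" "Min (snd ` P) \<le> y" "y \<le> Max (snd ` P)"
  using assms by (force intro!: Min_le Max_ge)+

text \<open>The two extra conditions fix the bounding rectangle: a full row makes the ones span the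
  whole width, nonempty bottom and top rows make them span the whole height. Conversely, the corner
  property forces a full row and a full column.\<close>

lemma L_Lconvex_iff:
  fixes n m :: nat and p :: "nat \<Rightarrow> nat \<Rightarrow> nat"
  assumes nm: "1 \<le> n" "1 \<le> m" and p01: "\<forall>x<n. \<forall>y<m. p x y \<in> {0, 1}"
    and w: "\<And>x y. w x y \<longleftrightarrow> inside (int n) (int m) x y \<and> p (nat x) (nat y) = 1"
    and pic: "picture (int n) (int m) w"
  shows "L_Lconvex n m p \<longleftrightarrow>
    l_convex (picture.ones w) \<and> picture.full_row (int n) (int m) w \<and> picture.rows_nonempty (int m) w"
proof -
  interpret picture "int n" "int m" w by (rule pic)
  show ?thesis
  proof
    assume "L_Lconvex n m p"
    then obtain P where P: "finite P" "P \<noteq> {}" "l_convex P" "assoc_picture P n m p"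
      unfolding L_Lconvex_def polyomino_def by blast
    have hv: "hv_convex P" using P(3) by (simp add: l_convex_def)
    define x0 x1 y0 y1 where defs: "x0 = Min (fst ` P)" "x1 = Max (fst ` P)"
      "y0 = Min (snd ` P)" "y1 = Max (snd ` P)"
    have dims: "int n = x1 - x0 + 1" "int m = y1 - y0 + 1"
      and pP: "\<And>x y. x < n \<Longrightarrow> y < m \<Longrightarrow> p x y = (if (x0 + int x, y0 + int y) \<in> P then 1 else 0)"
      using P(4) unfolding assoc_picture_def Let_def defs by auto
    note box = bounding_box_min_max[OF P(1), folded defs]
    have wP: "w x y \<longleftrightarrow> (x0 + x, y0 + y) \<in> P" for x y
    proof (cases "inside (int n) (int m) x y")
      case True
      hence "nat x < n" "nat y < m" by (auto simp: inside_def)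
      then show ?thesis using True pP[of "nat x" "nat y"] by (simp add: w inside_def)
    next
      case False
      then show ?thesis using box[of "x0 + x" "y0 + y"] dims by (auto simp: w inside_def)
    qed
    have "hv_convex ones"
      unfolding hv_convex_def in_ones wP
      using hv_convex_row[OF hv] hv_convex_column[OF hv] by (smt (verit))
    moreover have "\<forall>x1 y1 x2 y2. w x1 y1 \<longrightarrow> w x2 y2 \<longrightarrow> w x1 y2 \<or> w x2 y1"
      unfolding wP using l_convex_corner[OF P(3)] by blast
    ultimately have l: "l_convex ones" by (simp add: l_convex_def)
    have "x0 \<in> fst ` P" "x1 \<in> fst ` P" "y0 \<in> snd ` P" "y1 \<in> snd ` P"
      unfolding defs using P(1,2) by (auto intro!: Min_in Max_in)
    then obtain ya yb xa xb where ext: "(x0, ya) \<in> P" "(x1, yb) \<in> P" "(xa, y0) \<in> P" "(xb, y1) \<in> P"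
      by auto
    \<comment> \<open>Each of the two possible corners lies in an extreme column and shares its row
      with the opposite extreme cell.\<close>
    have "\<exists>y. (x0, y) \<in> P \<and> (x1, y) \<in> P"
      using l_convex_corner[OF P(3) ext(1,2)] ext by blast
    then obtain y where y: "(x0, y) \<in> P" "(x1, y) \<in> P" by blast
    have "w x (y - y0)" if "0 \<le> x" "x < int n" for x
      unfolding wP using hv_convex_row[OF hv y] that dims by auto
    moreover have "0 \<le> y - y0" "y - y0 < int m" using box[OF y(1)] dims by auto
    ultimately have f: full_row unfolding full_row_def by blast
    \<comment> \<open>The same argument gives a column from bottom to top, which meets every
      row.\<close>
    have "\<exists>x. (x, y0) \<in> P \<and> (x, y1) \<in> P"
      using l_convex_corner[OF P(3) ext(3,4)] ext by blast
    then obtain x where x: "(x, y0) \<in> P" "(x, y1) \<in> P" by blast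
    have "w (x - x0) y" if "0 \<le> y" "y < int m" for y
      unfolding wP using hv_convex_column[OF hv x] that dims by auto
    hence rows_nonempty unfolding rows_nonempty_def by blast
    with l f show "l_convex ones \<and> full_row \<and> rows_nonempty" by blast
  next
    assume "l_convex ones \<and> full_row \<and> rows_nonempty"
    hence l: "l_convex ones" and f: full_row and r: rows_nonempty by auto
    obtain y where y: "0 \<le> y" "y < int m" "\<And>x. 0 \<le> x \<Longrightarrow> x < int n \<Longrightarrow> w x y"
      using f unfolding full_row_def by blast
    have sub: "ones \<subseteq> {0..<int n} \<times> {0..<int m}"
      using w_inside by (auto simp: inside_def ones_def)
    have fin: "finite ones" by (rule finite_subset[OF sub]) simp
    have xs: "(0, y) \<in> ones" "(int n - 1, y) \<in> ones" using y(3) nm by auto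
    obtain xa xb where ys: "(xa, 0) \<in> ones" "(xb, int m - 1) \<in> ones"
      using r[unfolded rows_nonempty_def, rule_format, of 0]
        r[unfolded rows_nonempty_def, rule_format, of "int m - 1"] nm by auto
    have "Min (fst ` ones) = 0" "Max (fst ` ones) = int n - 1"
      "Min (snd ` ones) = 0" "Max (snd ` ones) = int m - 1"
      using fin sub rev_image_eqI[OF xs(1), of 0 fst] rev_image_eqI[OF xs(2), of "int n - 1" fst]
        rev_image_eqI[OF ys(1), of 0 snd] rev_image_eqI[OF ys(2), of "int m - 1" snd]
      by (auto intro!: Min_eqI Max_eqI)
    moreover have "p x y = (if (int x, int y) \<in> ones then 1 else 0)" if "x < n" "y < m" for x y
      using p01[rule_format, OF that] that by (auto simp: w inside_def)
    ultimately have "assoc_picture ones n m p" by (simp add: assoc_picture_def)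
    moreover have "polyomino ones"
      using fin xs l_convex_imp_connected4[OF l] unfolding polyomino_def by blast
    ultimately show "L_Lconvex n m p" unfolding L_Lconvex_def using l by blast
  qed
qed

section \<open>The automaton\<close>

text \<open>
  A state is a set of flags, and the cells outside the picture carry none. The parameter \<open>k\<close> of
  \<open>Down k\<close>, \<open>Up k\<close> selects the pair of rows: \<open>(d, c - 1)\<close> for true, \<open>(d + 1, c)\<close> for false.
  \<open>Down k\<close> tells that the stream from the upper row has arrived, \<open>DownBit k\<close> is its current entry.
  The midpoint is a cell if \<open>u - v\<close> is even; otherwise the lower of the two middle cells gets the
  upward stream one step early and compares with its entry of the previous time step. \<open>Unsync k e\<close>
  marks the cells that are not the midpoint for parity \<open>e\<close> (true for even).
\<close>
datatype track = Inside | One | Shift | SomeOneRight | SomeZeroRight | SomeOneUp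
  | EmptyRow | FullRow | Error
  | Down bool | DownBit bool | Up bool | UpBit bool | Unsync bool bool

instance track :: finite
proof
  have "(UNIV :: track set) = {Inside, One, Shift, SomeOneRight, SomeZeroRight, SomeOneUp,
      EmptyRow, FullRow, Error} \<union> range Down \<union> range DownBit \<union> range Up \<union> range UpBit
      \<union> range (case_prod Unsync)"
    (is "_ = ?A")
  proof (rule UNIV_eq_I)
    fix f show "f \<in> ?A" by (cases f) auto
  qed
  moreover have "finite ?A" by simp
  ultimately show "finite (UNIV :: track set)" by (simp only:)
qed

type_synonym state = "track \<Rightarrow> bool"

text \<open>These are the values of the closed forms below at time 0, when a cell has seen only
  itself.\<close>

definition init :: "bool \<Rightarrow> state" where
  "init b f \<longleftrightarrow> (case f of Inside \<Rightarrow> True | One \<Rightarrow> b | Shift \<Rightarrow> b | SomeOneRight \<Rightarrow> b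
     | SomeZeroRight \<Rightarrow> \<not> b | SomeOneUp \<Rightarrow> b | EmptyRow \<Rightarrow> \<not> b | FullRow \<Rightarrow> b | _ \<Rightarrow> False)"

definition outer :: state where "outer = (\<lambda>_. False)"

text \<open>A source recognises itself from entries that never change, hence from the first step on.
  The two cases are the topmost one of a run and the zero just above it.\<close>

definition down_source :: "bool \<Rightarrow> bool \<Rightarrow> bool \<Rightarrow> bool \<Rightarrow> bool" where
  "down_source k c u d \<longleftrightarrow> (if k then c \<and> \<not> u else \<not> c \<and> d)"

definition up_source :: "bool \<Rightarrow> bool \<Rightarrow> bool \<Rightarrow> bool \<Rightarrow> bool" where
  "up_source k c u d \<longleftrightarrow> (if k then \<not> c \<and> u else c \<and> \<not> d)"

text \<open>\<open>r Shift\<close> is the shifted entry that a source cell itself will hold at the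
  next time step; it overrides any bit passed on from another source.\<close>

fun stream :: "state \<Rightarrow> state \<Rightarrow> state \<Rightarrow> state \<Rightarrow> state" where
  "stream c r u d (Down k) \<longleftrightarrow> down_source k (c One) (u One) (d One) \<or> u (Down k)"
| "stream c r u d (DownBit k) \<longleftrightarrow>
     (if down_source k (c One) (u One) (d One) then r Shift else u (DownBit k))"
| "stream c r u d (Up k) \<longleftrightarrow> up_source k (c One) (u One) (d One) \<or> d (Up k)"
| "stream c r u d (UpBit k) \<longleftrightarrow>
     (if up_source k (c One) (u One) (d One) then r Shift else d (UpBit k))"
| "stream c r u d _ \<longleftrightarrow> False"

text \<open>The first two disjuncts look for gaps in the row and in the column. In the third, the
  upper and the lower tested row carry \<open>k\<close> and its negation at the column of the cell,
  so the opposite bits complete a forbidden pattern.\<close>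

definition error_at :: "state \<Rightarrow> state \<Rightarrow> state \<Rightarrow> state \<Rightarrow> bool" where
  "error_at c r u d \<longleftrightarrow>
     c One \<and> \<not> r One \<and> r SomeOneRight \<or>
     c One \<and> \<not> u One \<and> u SomeOneUp \<or>
     (\<exists>k e. let c' = (if e then stream c r u d else c) in
        \<not> c (Unsync k e) \<and> stream c r u d (Down k) \<and> c' (Up k) \<and>
        stream c r u d (DownBit k) = (\<not> k) \<and> c' (UpBit k) = k)"

fun update :: "state \<Rightarrow> state \<Rightarrow> state \<Rightarrow> state \<Rightarrow> state" where
  "update c r u d Inside \<longleftrightarrow> True"
| "update c r u d One \<longleftrightarrow> c One"
| "update c r u d Shift \<longleftrightarrow> r Shift"
| "update c r u d SomeOneRight \<longleftrightarrow> c One \<or> r SomeOneRight"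
| "update c r u d SomeZeroRight \<longleftrightarrow> \<not> c One \<or> r SomeZeroRight"
| "update c r u d SomeOneUp \<longleftrightarrow> c One \<or> u SomeOneUp"
| "update c r u d EmptyRow \<longleftrightarrow> \<not> (c One \<or> r SomeOneRight) \<or> u EmptyRow"
| "update c r u d FullRow \<longleftrightarrow> \<not> (\<not> c One \<or> r SomeZeroRight) \<or> u FullRow"
| "update c r u d Error \<longleftrightarrow> c Error \<or> r Error \<or> u Error \<or> error_at c r u d"
| "update c r u d (Unsync k e) \<longleftrightarrow> c (Unsync k e) \<or>
     stream c r u d (Down k) \<noteq> (if e then stream c r u d else c) (Up k)"
| "update c r u d f \<longleftrightarrow> stream c r u d f"

text \<open>Cells without \<open>Inside\<close> stay in state \<open>outer\<close>, so the
  surroundings of the picture never change.\<close>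

definition step :: "state \<Rightarrow> state \<Rightarrow> state \<Rightarrow> state \<Rightarrow> state" where
  "step c r u d f \<longleftrightarrow> c Inside \<and> update c r u d f"

text \<open>Unrolls one step of a signal that moves one cell per time unit towards smaller
  coordinates: it is either local or comes from \<open>a + 1\<close>.\<close>

lemma ex_le_Suc_shift:
  "(\<exists>s\<le>Suc t. P (a + int s)) \<longleftrightarrow> P a \<or> (\<exists>s\<le>t. P (a + 1 + int s))"
  (is "?L \<longleftrightarrow> ?R")
proof
  assume ?L
  then obtain s where "s \<le> Suc t" "P (a + int s)" by blast
  then show ?R by (cases s) (auto simp: algebra_simps)
next
  assume ?R
  then show ?L by (force simp: algebra_simps intro: exI[of _ "0::nat"] exI[of _ "Suc _"])
qed

lemma ex_le_Suc_shift_time: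
  "(\<exists>s\<le>Suc t. P (a + int s) (Suc t - s)) \<longleftrightarrow> P a (Suc t) \<or> (\<exists>s\<le>t. P (a + 1 + int s) (t - s))"
  (is "?L \<longleftrightarrow> ?R")
proof
  assume ?L
  then obtain s where "s \<le> Suc t" "P (a + int s) (Suc t - s)" by blast
  then show ?R by (cases s) (auto simp: algebra_simps)
next
  assume ?R
  then show ?L by (force simp: algebra_simps intro: exI[of _ "0::nat"] exI[of _ "Suc _"])
qed

lemma int_last_before_change:
  fixes a b :: int
  assumes "P a" "\<not> P b" "a < b"
  shows "\<exists>c. a \<le> c \<and> c < b \<and> P c \<and> \<not> P (c + 1)"
proof (rule ccontr)
  assume neg: "\<not> ?thesis"
  have "P c" if "a \<le> c" "c \<le> b" for c
    using that
  proof (induction c rule: int_ge_induct)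
    case (step c)
    with neg show ?case by force
  qed (use assms in simp)
  with assms show False by force
qed

section \<open>Closed forms of the flags during a run\<close>

context picture
begin

text \<open>The run in unencoded states. The left neighbour is never read: information moves only
  left, up and down.\<close>

fun conf :: "nat \<Rightarrow> int \<Rightarrow> int \<Rightarrow> state" where
  "conf 0 x y = (if inside n m x y then init (w x y) else outer)"
| "conf (Suc t) x y = step (conf t x y) (conf t (x + 1) y) (conf t x (y + 1)) (conf t x (y - 1))"

lemma conf_Inside [simp]: "conf t x y Inside \<longleftrightarrow> inside n m x y"
  by (induction t arbitrary: x y) (auto simp: step_def init_def outer_def)

lemma conf_outside: "\<not> inside n m x y \<Longrightarrow> \<not> conf t x y f"
  by (cases t) (auto simp: step_def outer_def)

lemma conf_One [simp]: "conf t x y One \<longleftrightarrow> w x y"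
  using w_inside by (induction t arbitrary: x y) (auto simp: step_def init_def outer_def)

lemma conf_Shift: "conf t x y Shift \<longleftrightarrow> inside n m x y \<and> w (x + int t) y"
proof (induction t arbitrary: x y)
  case (Suc t)
  \<comment> \<open>Beyond the border all flags are off, which agrees with \<open>w\<close> there;
    the same border argument recurs below.\<close>
  have "\<not> w (x + 1 + int t) y" if "inside n m x y" "\<not> inside n m (x + 1) y"
    using that w_inside[of "x + 1 + int t" y] by (auto simp: inside_def)
  then show ?case by (auto simp: step_def Suc algebra_simps)
qed (simp add: init_def outer_def)

lemma conf_SomeOneRight:
  "conf t x y SomeOneRight \<longleftrightarrow> inside n m x y \<and> (\<exists>s\<le>t. w (x + int s) y)"
proof (induction t arbitrary: x y)
  case (Suc t)
  have "\<not> w (x + 1 + int s) y" if "inside n m x y" "\<not> inside n m (x + 1) y" for s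
    using that w_inside[of "x + 1 + int s" y] by (auto simp: inside_def)
  then show ?case
    unfolding ex_le_Suc_shift[where P = "\<lambda>x. w x y"] by (auto simp: step_def Suc)
qed (simp add: init_def outer_def)

lemma conf_SomeOneUp:
  "conf t x y SomeOneUp \<longleftrightarrow> inside n m x y \<and> (\<exists>s\<le>t. w x (y + int s))"
proof (induction t arbitrary: x y)
  case (Suc t)
  have "\<not> w x (y + 1 + int s)" if "inside n m x y" "\<not> inside n m x (y + 1)" for s
    using that w_inside[of x "y + 1 + int s"] by (auto simp: inside_def)
  then show ?case
    unfolding ex_le_Suc_shift[where P = "\<lambda>y. w x y"] by (auto simp: step_def Suc)
qed (simp add: init_def outer_def)

text \<open>Zeros count only inside the picture, because \<open>w\<close> is False beyond the border
  as well.\<close>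

lemma conf_SomeZeroRight:
  "conf t x y SomeZeroRight \<longleftrightarrow>
     inside n m x y \<and> (\<exists>s\<le>t. inside n m (x + int s) y \<and> \<not> w (x + int s) y)"
proof (induction t arbitrary: x y)
  case (Suc t)
  have "\<not> inside n m (x + 1 + int s) y" if "inside n m x y" "\<not> inside n m (x + 1) y" for s
    using that by (auto simp: inside_def)
  then show ?case
    unfolding ex_le_Suc_shift[where P = "\<lambda>x. inside n m x y \<and> \<not> w x y"]
    by (auto simp: step_def Suc)
qed (simp add: init_def outer_def)

text \<open>The flag does not accumulate over time: it reports on row \<open>y + int s\<close> as
  seen at time \<open>t - s\<close>. Premature reports thus pass the origin and are
  forgotten.\<close>

lemma conf_EmptyRow:
  "conf t x y EmptyRow \<longleftrightarrow> inside n m x y \<and>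
     (\<exists>s\<le>t. inside n m x (y + int s) \<and> \<not> conf (t - s) x (y + int s) SomeOneRight)"
proof (induction t arbitrary: x y)
  case (Suc t)
  have "\<not> inside n m x (y + 1 + int s)" if "inside n m x y" "\<not> inside n m x (y + 1)" for s
    using that by (auto simp: inside_def)
  then show ?case
    unfolding ex_le_Suc_shift_time[where P = "\<lambda>y t. inside n m x y \<and> \<not> conf t x y SomeOneRight"]
    by (auto simp: step_def Suc)
qed (simp add: init_def outer_def)

lemma conf_FullRow:
  "conf t x y FullRow \<longleftrightarrow> inside n m x y \<and>
     (\<exists>s\<le>t. inside n m x (y + int s) \<and> \<not> conf (t - s) x (y + int s) SomeZeroRight)"
proof (induction t arbitrary: x y)
  case (Suc t)
  have "\<not> inside n m x (y + 1 + int s)" if "inside n m x y" "\<not> inside n m x (y + 1)" for s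
    using that by (auto simp: inside_def)
  then show ?case
    unfolding ex_le_Suc_shift_time[where P = "\<lambda>y t. inside n m x y \<and> \<not> conf t x y SomeZeroRight"]
    by (auto simp: step_def Suc)
qed (simp add: init_def outer_def)

section \<open>Row streams redirected into a column\<close>

definition sends_down :: "bool \<Rightarrow> int \<Rightarrow> int \<Rightarrow> bool" where
  "sends_down k x y \<longleftrightarrow> inside n m x y \<and> down_source k (w x y) (w x (y + 1)) (w x (y - 1))"

definition sends_up :: "bool \<Rightarrow> int \<Rightarrow> int \<Rightarrow> bool" where
  "sends_up k x y \<longleftrightarrow> inside n m x y \<and> up_source k (w x y) (w x (y + 1)) (w x (y - 1))"

lemma conf_Shift_right: "inside n m x y \<Longrightarrow> conf t (x + 1) y Shift \<longleftrightarrow> w (x + int (Suc t)) y"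
  using w_inside[of "x + int (Suc t)" y] by (auto simp: conf_Shift inside_def algebra_simps)

text \<open>The bound is strict because sources first emit at time 1. The bit is left open, since
  another source on the way would replace it.\<close>

lemma Down_arrives:
  assumes "sends_down k x (y + int j)" "inside n m x y" "j < t"
  shows "conf t x y (Down k)"
  using assms
proof (induction j arbitrary: y t)
  case 0
  then obtain t' where "t = Suc t'" by (cases t) auto
  with 0 show ?case by (simp add: step_def sends_down_def)
next
  case (Suc j)
  then obtain t' where t: "t = Suc t'" by (cases t) auto
  have "conf t' x (y + 1) (Down k)"
    using Suc t by (intro Suc.IH) (auto simp: sends_down_def inside_def algebra_simps)
  with Suc t show ?case by (simp add: step_def)
qed

lemma Up_arrives:
  assumes "sends_up k x (y - int j)" "inside n m x y" "j < t"
  shows "conf t x y (Up k)"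
  using assms
proof (induction j arbitrary: y t)
  case 0
  then obtain t' where "t = Suc t'" by (cases t) auto
  with 0 show ?case by (simp add: step_def sends_up_def)
next
  case (Suc j)
  then obtain t' where t: "t = Suc t'" by (cases t) auto
  have "conf t' x (y - 1) (Up k)"
    using Suc t by (intro Suc.IH) (auto simp: sends_up_def inside_def algebra_simps)
  with Suc t show ?case by (simp add: step_def)
qed

text \<open>A bit at distance \<open>j\<close> left its source at time \<open>t - j\<close>, when
  the shifted row showed column \<open>x + int (t - j)\<close> there.\<close>

lemma Down_origin:
  assumes "conf t x y (Down k)"
  shows "\<exists>j<t. sends_down k x (y + int j) \<and>
    conf t x y (DownBit k) = w (x + int (t - j)) (y + int j)"
  using assms
proof (induction t arbitrary: y)
  case 0
  then show ?case by (auto simp: init_def outer_def split: if_splits)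
next
  case (Suc t)
  have ins: "inside n m x y" using Suc.prems conf_outside by blast
  show ?case
  proof (cases "sends_down k x y")
    case True
    with ins show ?thesis
      by (intro exI[of _ 0]) (auto simp: step_def sends_down_def conf_Shift_right)
  next
    case False
    with ins have src: "\<not> down_source k (w x y) (w x (y + 1)) (w x (y - 1))"
      by (simp add: sends_down_def)
    with Suc.prems ins have "conf t x (y + 1) (Down k)" by (simp add: step_def)
    from Suc.IH[OF this] obtain j where "j < t" "sends_down k x (y + 1 + int j)"
      "conf t x (y + 1) (DownBit k) = w (x + int (t - j)) (y + 1 + int j)" by blast
    with src ins show ?thesis
      by (intro exI[of _ "Suc j"]) (auto simp: step_def algebra_simps)
  qed
qed

lemma Up_origin:
  assumes "conf t x y (Up k)"
  shows "\<exists>j<t. sends_up k x (y - int j) \<and>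
    conf t x y (UpBit k) = w (x + int (t - j)) (y - int j)"
  using assms
proof (induction t arbitrary: y)
  case 0
  then show ?case by (auto simp: init_def outer_def split: if_splits)
next
  case (Suc t)
  have ins: "inside n m x y" using Suc.prems conf_outside by blast
  show ?case
  proof (cases "sends_up k x y")
    case True
    with ins show ?thesis
      by (intro exI[of _ 0]) (auto simp: step_def sends_up_def conf_Shift_right)
  next
    case False
    with ins have src: "\<not> up_source k (w x y) (w x (y + 1)) (w x (y - 1))"
      by (simp add: sends_up_def)
    with Suc.prems ins have "conf t x (y - 1) (Up k)" by (simp add: step_def)
    from Suc.IH[OF this] obtain j where "j < t" "sends_up k x (y - 1 - int j)"
      "conf t x (y - 1) (UpBit k) = w (x + int (t - j)) (y - 1 - int j)" by blast
    with src ins show ?thesis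
      by (intro exI[of _ "Suc j"]) (auto simp: step_def algebra_simps)
  qed
qed

section \<open>Streams in convex columns\<close>

lemma column_convexD:
  "hv_convex ones \<Longrightarrow> w x a \<Longrightarrow> w x b \<Longrightarrow> a \<le> c \<Longrightarrow> c \<le> b \<Longrightarrow> w x c"
  using hv_convex_column[of ones x a b c] by simp

text \<open>The ones of a convex column form a single run with a single upper end. This makes
  arrival times and bits exact.\<close>

lemma sends_down_unique:
  assumes hv: "hv_convex ones" and "sends_down k x a" "sends_down k x b"
  shows "a = b"
proof -
  have "\<not> a < b" if "sends_down k x a" "sends_down k x b" for a b
    using that column_convexD[OF hv, of x a b "a + 1"] column_convexD[OF hv, of x "a - 1" "b - 1" a]
    by (auto simp: sends_down_def down_source_def split: if_splits)
  from this[of a b] this[of b a] assms show ?thesis by auto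
qed

lemma sends_up_unique:
  assumes hv: "hv_convex ones" and "sends_up k x a" "sends_up k x b"
  shows "a = b"
proof -
  have "\<not> a < b" if "sends_up k x a" "sends_up k x b" for a b
    using that column_convexD[OF hv, of x "a + 1" "b + 1" b] column_convexD[OF hv, of x a b "b - 1"]
    by (auto simp: sends_up_def up_source_def split: if_splits)
  from this[of a b] this[of b a] assms show ?thesis by auto
qed

lemma Down_iff:
  assumes hv: "hv_convex ones" and "inside n m x y" and src: "sends_down k x (y + int j)"
  shows "conf t x y (Down k) \<longleftrightarrow> j < t"
    and "j < t \<Longrightarrow> conf t x y (DownBit k) = w (x + int (t - j)) (y + int j)"
proof -
  have *: "i = j" if "sends_down k x (y + int i)" for i
    using sends_down_unique[OF hv that src] by simp
  show "conf t x y (Down k) \<longleftrightarrow> j < t"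
    using Down_arrives[OF src assms(2)] Down_origin[of t x y k] * by blast
  thus "j < t \<Longrightarrow> conf t x y (DownBit k) = w (x + int (t - j)) (y + int j)"
    using Down_origin[of t x y k] * by blast
qed

lemma Up_iff:
  assumes hv: "hv_convex ones" and "inside n m x y" and src: "sends_up k x (y - int j)"
  shows "conf t x y (Up k) \<longleftrightarrow> j < t"
    and "j < t \<Longrightarrow> conf t x y (UpBit k) = w (x + int (t - j)) (y - int j)"
proof -
  have *: "i = j" if "sends_up k x (y - int i)" for i
    using sends_up_unique[OF hv that src] by simp
  show "conf t x y (Up k) \<longleftrightarrow> j < t"
    using Up_arrives[OF src assms(2)] Up_origin[of t x y k] * by blast
  thus "j < t \<Longrightarrow> conf t x y (UpBit k) = w (x + int (t - j)) (y - int j)"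
    using Up_origin[of t x y k] * by blast
qed

lemma conf_Unsync:
  assumes "inside n m x y"
  shows "conf t x y (Unsync k e) \<longleftrightarrow>
    (\<exists>s<t. conf (Suc s) x y (Down k) \<noteq> conf (if e then Suc s else s) x y (Up k))"
proof (induction t)
  case (Suc t)
  have "conf (Suc t) x y (Unsync k e) \<longleftrightarrow> conf t x y (Unsync k e) \<or>
    conf (Suc t) x y (Down k) \<noteq> conf (if e then Suc t else t) x y (Up k)"
    using assms by (simp add: step_def)
  with Suc show ?case by (auto simp: less_Suc_eq simp del: conf.simps)
qed (use assms in \<open>simp add: init_def\<close>)

section \<open>Error signals\<close>

definition fires :: "nat \<Rightarrow> int \<Rightarrow> int \<Rightarrow> bool" where
  "fires t x y \<longleftrightarrow> inside n m x y \<and>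
     error_at (conf t x y) (conf t (x + 1) y) (conf t x (y + 1)) (conf t x (y - 1))"

definition mismatch :: "bool \<Rightarrow> bool \<Rightarrow> nat \<Rightarrow> int \<Rightarrow> int \<Rightarrow> bool" where
  "mismatch k e t x y \<longleftrightarrow> (let t' = (if e then Suc t else t) in
     \<not> conf t x y (Unsync k e) \<and> conf (Suc t) x y (Down k) \<and> conf t' x y (Up k) \<and>
     conf (Suc t) x y (DownBit k) = (\<not> k) \<and> conf t' x y (UpBit k) = k)"

lemma fires_iff:
  "fires t x y \<longleftrightarrow> inside n m x y \<and>
     (w x y \<and> \<not> w (x + 1) y \<and> (\<exists>s\<le>t. w (x + 1 + int s) y) \<or>
      w x y \<and> \<not> w x (y + 1) \<and> (\<exists>s\<le>t. w x (y + 1 + int s)) \<or>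
      (\<exists>k e. mismatch k e t x y))"
proof -
  have "inside n m (x + 1) y" if "inside n m x y" "w (x + 1 + int s) y" for s
    using that(1) w_inside[OF that(2)] by (auto simp: inside_def)
  hence "conf t (x + 1) y SomeOneRight \<longleftrightarrow> (\<exists>s\<le>t. w (x + 1 + int s) y)" if "inside n m x y"
    using that by (auto simp: conf_SomeOneRight)
  moreover have "inside n m x (y + 1)" if "inside n m x y" "w x (y + 1 + int s)" for s
    using that(1) w_inside[OF that(2)] by (auto simp: inside_def)
  hence "conf t x (y + 1) SomeOneUp \<longleftrightarrow> (\<exists>s\<le>t. w x (y + 1 + int s))" if "inside n m x y"
    using that by (auto simp: conf_SomeOneUp)
  moreover have "mismatch k e t x y \<longleftrightarrow>
      (let c = conf t x y; r = conf t (x + 1) y; u = conf t x (y + 1); d = conf t x (y - 1);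
        c' = (if e then stream c r u d else c) in
        \<not> c (Unsync k e) \<and> stream c r u d (Down k) \<and> c' (Up k) \<and>
        stream c r u d (DownBit k) = (\<not> k) \<and> c' (UpBit k) = k)" if "inside n m x y" for k e
    using that by (simp add: mismatch_def step_def Let_def)
  ultimately show ?thesis
    unfolding fires_def error_at_def Let_def by (simp cong: conj_cong)
qed

lemma Error_origin: "conf t x y Error \<Longrightarrow> \<exists>s x' y'. fires s x' y'"
proof (induction t arbitrary: x y)
  case 0
  then show ?case by (auto simp: init_def outer_def split: if_splits)
next
  case (Suc t)
  then show ?case by (auto simp: step_def fires_def)
qed

text \<open>The error goes left along row \<open>y\<close> to column 0, then down to the origin, and
  waits there for the remaining time.\<close>

lemma fires_reaches_origin:
  assumes "fires s x y" "int (Suc s) + x + y \<le> int t"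
  shows "conf t 0 0 Error"
proof -
  have ins: "inside n m x y" using assms(1) by (simp add: fires_def)
  have mono: "conf (t + i) x y Error" if "conf t x y Error" for t i x y
  proof (induction i)
    case (Suc i)
    then show ?case using conf_outside[of x y] by (auto simp: step_def)
  qed (use that in simp)
  have left: "conf (t + i) (x - int i) y Error" if "conf t x y Error" "int i \<le> x" for t i x y
    using that
  proof (induction i)
    case (Suc i)
    hence "conf (t + i) (x - int i) y Error" by simp
    moreover from this have "inside n m (x - int i) y" using conf_outside by blast
    hence "inside n m (x - int (Suc i)) y" using Suc.prems by (auto simp: inside_def)
    ultimately show ?case by (simp add: step_def algebra_simps)
  qed simp
  have down: "conf (t + i) x (y - int i) Error" if "conf t x y Error" "int i \<le> y" for t i x y
    using that
  proof (induction i)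
    case (Suc i)
    hence "conf (t + i) x (y - int i) Error" by simp
    moreover from this have "inside n m x (y - int i)" using conf_outside by blast
    hence "inside n m x (y - int (Suc i))" using Suc.prems by (auto simp: inside_def)
    ultimately show ?case by (simp add: step_def algebra_simps)
  qed simp
  have "conf (Suc s) x y Error" using assms(1) by (simp add: fires_def step_def)
  from left[OF this, of "nat x"] have "conf (Suc s + nat x) 0 y Error"
    using ins by (simp add: inside_def del: conf.simps)
  from down[OF this, of "nat y"] have "conf (Suc s + nat x + nat y) 0 0 Error"
    using ins by (simp add: inside_def del: conf.simps)
  from mono[OF this, of "t - (Suc s + nat x + nat y)"]
  have "conf (Suc s + nat x + nat y + (t - (Suc s + nat x + nat y))) 0 0 Error" .
  moreover have "Suc s + nat x + nat y + (t - (Suc s + nat x + nat y)) = t"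
    using assms(2) ins unfolding inside_def by linarith
  ultimately show ?thesis by (simp only:)
qed

section \<open>L-convex pictures raise no error\<close>

lemma no_mismatch:
  assumes l: "l_convex ones" and ins: "inside n m x y"
  shows "\<not> mismatch k e t x y"
proof
  assume mis: "mismatch k e t x y"
  have hv: "hv_convex ones" using l by (simp add: l_convex_def)
  define t' where "t' = (if e then Suc t else t)"
  have sync: "conf (Suc s) x y (Down k) = conf (if e then Suc s else s) x y (Up k)" if "s < t" for s
    using mis that unfolding mismatch_def conf_Unsync[OF ins] Let_def by blast
  have dn: "conf (Suc t) x y (Down k)" "conf (Suc t) x y (DownBit k) = (\<not> k)"
    and up: "conf t' x y (Up k)" "conf t' x y (UpBit k) = k"
    using mis unfolding mismatch_def Let_def t'_def by blast+
  obtain j where j: "j < Suc t" "sends_down k x (y + int j)" using Down_origin[OF dn(1)] by blast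
  obtain i where i: "i < t'" "sends_up k x (y - int i)" using Up_origin[OF up(1)] by blast
  note D = Down_iff[OF hv ins j(2)] and U = Up_iff[OF hv ins i(2)]
  \<comment> \<open>All earlier comparisons agreed, so the two streams started to arrive together,
    up to the shift by one step for odd parity.\<close>
  have sync': "j < Suc s \<longleftrightarrow> i < (if e then Suc s else s)" if "s < t" for s
    using sync[OF that] unfolding D(1) U(1) .
  \<comment> \<open>Hence \<open>j\<close> is \<open>i\<close> or \<open>Suc i\<close> according to
    \<open>e\<close>, and both bits stem from the same column \<open>X\<close>.\<close>
  have eq: "Suc t - j = t' - i"
  proof (cases e)
    case True
    with sync'[of i] sync'[of j] i j show ?thesis by (cases i j rule: linorder_cases) (auto simp: t'_def)
  next
    case False
    have "j = Suc i"
      using False sync'[of "Suc i"] sync'[of j] i(1) j(1)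
      by (cases j "Suc i" rule: linorder_cases) (auto simp: t'_def)
    with False show ?thesis by (simp add: t'_def)
  qed
  define X where "X = x + int (Suc t - j)"
  have X: "w X (y + int j) \<longleftrightarrow> \<not> k" "w X (y - int i) \<longleftrightarrow> k"
    using dn(2) up(2) D(2)[OF j(1)] U(2)[OF i(1)] eq by (auto simp: X_def)
  \<comment> \<open>At \<open>x\<close> the source above has entry \<open>k\<close> and the one
    below its negation; at \<open>X\<close> it is the reverse. Which diagonal holds the ones depends
    on \<open>k\<close>.\<close>
  show False
    using X j(2) i(2) l_convex_corner[OF l, of x "y + int j" X "y - int i"]
      l_convex_corner[OF l, of x "y - int i" X "y + int j"]
    by (cases k) (auto simp: sends_down_def sends_up_def down_source_def up_source_def)
qed

lemma no_error:
  assumes l: "l_convex ones"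
  shows "\<not> conf t 0 0 Error"
proof
  assume "conf t 0 0 Error"
  then obtain s x y where f: "fires s x y" using Error_origin by blast
  have hv: "hv_convex ones" using l by (simp add: l_convex_def)
  from f consider (row) r where "w x y" "\<not> w (x + 1) y" "w (x + 1 + int r) y"
    | (column) r where "w x y" "\<not> w x (y + 1)" "w x (y + 1 + int r)"
    | (minor) k e where "inside n m x y" "mismatch k e s x y"
    unfolding fires_iff by blast
  then show False
  proof cases
    case row
    then show False using hv_convex_row[OF hv, of x y "x + 1 + int r" "x + 1"] by simp
  next
    case column
    then show False using column_convexD[OF hv, of x y "y + 1 + int r" "y + 1"] by simp
  next
    case minor
    then show False using no_mismatch[OF l] by blast
  qed
qed

section \<open>Every violation is detected in real time\<close>

lemma mismatch_fires:
  assumes hv: "hv_convex ones" and src: "sends_down k x u" "sends_up k x v" and "v < u" "x < X"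
    and bits: "w X u = (\<not> k)" "w X v = k"
  shows "\<exists>t y. fires t x y \<and> int (Suc t) + x + y = X + u"
proof -
  \<comment> \<open>The midpoint rounded down: the distance \<open>j\<close> to the upper source
    exceeds the distance \<open>i\<close> to the lower one by at most 1.\<close>
  define y where "y = (u + v) div 2"
  define i j where "i = nat (y - v)" and "j = nat (u - y)"
  have y: "v \<le> y" "y \<le> u" using \<open>v < u\<close> by (auto simp: y_def)
  have ij: "y + int j = u" "y - int i = v" using y by (auto simp: i_def j_def)
  have par: "j = i \<or> j = Suc i" unfolding i_def j_def y_def by linarith
  define e where "e = (j = i)"
  \<comment> \<open>The entry of row \<open>u\<close> in column \<open>X\<close> takes
    \<open>X - x\<close> steps to the left and \<open>j\<close> steps down; the comparison belongs
    to the step that ends at this time.\<close>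
  define t where "t = nat (X - x) + j - 1"
  define t' where "t' = (if e then Suc t else t)"
  have Suc_t: "Suc t = nat (X - x) + j" using \<open>x < X\<close> by (simp add: t_def)
  have t': "t' = nat (X - x) + i" using Suc_t par by (auto simp: t'_def e_def)
  have ins: "inside n m x y"
    using y src by (auto simp: sends_down_def sends_up_def inside_def)
  note D = Down_iff[OF hv ins src(1)[folded ij]] and U = Up_iff[OF hv ins src(2)[folded ij]]
  have "\<not> conf t x y (Unsync k e)"
    unfolding conf_Unsync[OF ins] D(1) U(1) using par by (auto simp: e_def)
  moreover have lt: "j < Suc t" "i < t'" using \<open>x < X\<close> by (auto simp: Suc_t t')
  moreover have "conf (Suc t) x y (DownBit k) = (\<not> k)" "conf t' x y (UpBit k) = k"
    using D(2)[OF lt(1)] U(2)[OF lt(2)] bits ij \<open>x < X\<close> by (auto simp: Suc_t t' simp del: conf.simps)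
  ultimately have "mismatch k e t x y"
    unfolding mismatch_def Let_def t'_def[symmetric] D(1) U(1) by blast
  hence "fires t x y" using ins by (auto simp: fires_iff)
  moreover have "int (Suc t) + x + y = X + u" using ij \<open>x < X\<close> by (simp add: Suc_t)
  ultimately show ?thesis by blast
qed

text \<open>Any forbidden pattern can be moved to a tested pair of rows at its left column: the rows
  are pushed to the ends of the run of ones in column \<open>x1\<close>. The full row crosses this
  run, and with it convexity of column \<open>x2\<close> yields the required entries there.\<close>

lemma bad_minor_error:
  assumes hv: "hv_convex ones" and full: full_row
    and "x1 < x2" "y2 < y1" and T: "int T = n + m - 2"
    and minor: "w x1 y1 = k" "w x1 y2 = (\<not> k)" "w x2 y2 = k" "w x2 y1 = (\<not> k)"
    and ins: "inside n m x1 y1" "inside n m x2 y2"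
  shows "conf T 0 0 Error"
proof -
  obtain ys where ys: "\<And>x. 0 \<le> x \<Longrightarrow> x < n \<Longrightarrow> w x ys"
    using full unfolding full_row_def by blast
  have ys: "w x1 ys" "w x2 ys" using ys ins by (auto simp: inside_def)
  note conv = column_convexD[OF hv]
  have "\<exists>u v. sends_down k x1 u \<and> sends_up k x1 v \<and> v < u \<and> w x2 u = (\<not> k) \<and> w x2 v = k"
  proof (cases k)
    case True
    \<comment> \<open>The zero beyond the border guarantees an upper end of the run even if it
      touches the top row.\<close>
    have "\<not> w x1 m" using w_inside[of x1 m] by (auto simp: inside_def)
    with int_last_before_change[of "w x1" y1 m] obtain u
      where u: "y1 \<le> u" "u < m" "w x1 u" "\<not> w x1 (u + 1)"
      using True minor ins by (auto simp: inside_def)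
    from int_last_before_change[of "\<lambda>y. \<not> w x1 y" y2 y1] obtain v
      where v: "y2 \<le> v" "v < y1" "\<not> w x1 v" "w x1 (v + 1)"
      using True minor \<open>y2 < y1\<close> by auto
    \<comment> \<open>The full row meets column \<open>x1\<close> in its run, hence above
      \<open>v\<close>; column \<open>x2\<close> has ones at \<open>y2\<close> and
      \<open>ys\<close>, hence at \<open>v\<close> in between.\<close>
    have "\<not> ys \<le> v" using conv[of x1 ys "v + 1" v] ys v by auto
    hence "w x2 v" using conv[of x2 y2 ys v] ys v minor True by auto
    moreover have "\<not> w x2 u" using conv[of x2 y2 u y1] u minor True \<open>y2 < y1\<close> by auto
    ultimately show ?thesis using u v ins True
      by (intro exI[of _ u] exI[of _ v])
        (auto simp: sends_down_def sends_up_def down_source_def up_source_def inside_def)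
  next
    case False
    from int_last_before_change[of "w x1" y2 y1] obtain u
      where u: "y2 \<le> u" "u < y1" "w x1 u" "\<not> w x1 (u + 1)"
      using False minor \<open>y2 < y1\<close> by auto
    \<comment> \<open>Here \<open>v\<close> is the zero below the run and may be -1; the upward
      source is \<open>v + 1\<close>, which is inside.\<close>
    have "\<not> w x1 (-1)" using w_inside[of x1 "-1"] by (auto simp: inside_def)
    with int_last_before_change[of "\<lambda>y. \<not> w x1 y" "-1" y2] obtain v
      where v: "-1 \<le> v" "v < y2" "\<not> w x1 v" "w x1 (v + 1)"
      using False minor ins by (auto simp: inside_def)
    have "\<not> u + 1 \<le> ys" using conv[of x1 u ys "u + 1"] ys u by auto
    hence "w x2 (u + 1)" using conv[of x2 ys y1 "u + 1"] ys u minor False by auto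
    moreover have "\<not> w x2 (v + 1)"
      using conv[of x2 "v + 1" y1 y2] v minor False \<open>y2 < y1\<close> by auto
    ultimately show ?thesis using u v ins False
      by (intro exI[of _ "u + 1"] exI[of _ "v + 1"])
        (auto simp: sends_down_def sends_up_def down_source_def up_source_def inside_def)
  qed
  then obtain u v where uv: "sends_down k x1 u" "sends_up k x1 v" "v < u" "w x2 u = (\<not> k)" "w x2 v = k"
    by blast
  obtain t y where ty: "fires t x1 y" "int (Suc t) + x1 + y = x2 + u"
    using mismatch_fires[OF hv uv(1-3) \<open>x1 < x2\<close> uv(4,5)] by blast
  have "x2 + u \<le> int T" using T ins uv(1) by (auto simp: sends_down_def inside_def)
  with ty show ?thesis using fires_reaches_origin[OF ty(1)] by simp
qed

lemma l_convex_if_no_error: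
  assumes full: full_row and T: "int T = n + m - 2" and noerr: "\<not> conf T 0 0 Error"
  shows "l_convex ones"
proof -
  have row: "w x y" if prems: "w x1 y" "w x2 y" "x1 \<le> x" "x \<le> x2" for x1 x2 x y
  proof (rule ccontr)
    assume "\<not> w x y"
    hence "x1 < x" "x < x2" using prems by (auto simp: order_le_less)
    with int_last_before_change[of "\<lambda>x. w x y" x1 x] obtain c
      where c: "x1 \<le> c" "c < x" "w c y" "\<not> w (c + 1) y" using prems \<open>\<not> w x y\<close> by auto
    \<comment> \<open>The one at \<open>x2\<close> is known to the cell in column
      \<open>c + 1\<close> after \<open>x2 - c - 1\<close> steps.\<close>
    have "fires (nat (x2 - c - 1)) c y"
      unfolding fires_iff using c prems w_inside[OF c(3)] \<open>x < x2\<close> by auto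
    moreover have "int (Suc (nat (x2 - c - 1))) + c + y \<le> int T"
      using c T w_inside[OF prems(2)] \<open>x < x2\<close> by (auto simp: inside_def)
    ultimately show False using fires_reaches_origin noerr by blast
  qed
  have col: "w x y" if prems: "w x y1" "w x y2" "y1 \<le> y" "y \<le> y2" for x y1 y2 y
  proof (rule ccontr)
    assume "\<not> w x y"
    hence "y1 < y" "y < y2" using prems by (auto simp: order_le_less)
    with int_last_before_change[of "w x" y1 y] obtain c
      where c: "y1 \<le> c" "c < y" "w x c" "\<not> w x (c + 1)" using prems \<open>\<not> w x y\<close> by auto
    have "fires (nat (y2 - c - 1)) x c"
      unfolding fires_iff using c prems w_inside[OF c(3)] \<open>y < y2\<close> by auto
    moreover have "int (Suc (nat (y2 - c - 1))) + x + c \<le> int T"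
      using c T w_inside[OF prems(2)] \<open>y < y2\<close> by (auto simp: inside_def)
    ultimately show False using fires_reaches_origin noerr by blast
  qed
  \<comment> \<open>Convexity comes first, since the detection of forbidden patterns relies on
    it.\<close>
  have hv: "hv_convex ones" unfolding hv_convex_def in_ones using row col by blast
  have "w x1 y2 \<or> w x2 y1" if "w x1 y1" "w x2 y2" for x1 y1 x2 y2
  proof (rule ccontr)
    assume neg: "\<not> (w x1 y2 \<or> w x2 y1)"
    \<comment> \<open>With the columns ordered, the cases \<open>d < b\<close> and
      \<open>b < d\<close> are the two kinds of pattern, for \<open>k\<close> true and
      false.\<close>
    have *: "w a d \<or> w c b" if "w a b" "w c d" "a < c" for a b c d
    proof (rule ccontr)
      assume "\<not> (w a d \<or> w c b)"
      moreover have "b \<noteq> d" using calculation that by auto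
      moreover have "inside n m a d" "inside n m c b" "inside n m a b" "inside n m c d"
        using w_inside that by (auto simp: inside_def)
      ultimately show False
        using bad_minor_error[OF hv full \<open>a < c\<close> _ T, of d b True]
          bad_minor_error[OF hv full \<open>a < c\<close> _ T, of b d False] that noerr
        by (cases b d rule: linorder_cases) auto
    qed
    from *[of x1 y1 x2 y2] *[of x2 y2 x1 y1] that neg show False
      by (cases x1 x2 rule: linorder_cases) auto
  qed
  with hv show ?thesis by (simp add: l_convex_def)
qed

section \<open>Full and empty rows\<close>

lemma FullRow_iff:
  assumes "1 \<le> n" "1 \<le> m" and T: "int T = n + m - 2"
  shows "conf T 0 0 FullRow \<longleftrightarrow> full_row"
proof -
  have le_T: "s \<le> T" if "int s < m" for s using assms that by linarith
  \<comment> \<open>The report on row \<open>s\<close> leaves at time \<open>T - s\<close>, which is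
    at least \<open>n - 1\<close>; by then the leftmost cell has seen its whole row.\<close>
  have row: "conf (T - s) 0 (int s) SomeZeroRight \<longleftrightarrow> (\<exists>x. 0 \<le> x \<and> x < n \<and> \<not> w x (int s))"
    if "int s < m" for s
  proof -
    have "\<exists>r\<le>T - s. inside n m (int r) (int s) \<and> \<not> w (int r) (int s)"
      if "0 \<le> x" "x < n" "\<not> w x (int s)" for x
      using that T \<open>int s < m\<close> by (intro exI[of _ "nat x"]) (auto simp: inside_def)
    moreover have "inside n m 0 (int s)" using that assms by (auto simp: inside_def)
    ultimately show ?thesis by (auto simp: conf_SomeZeroRight inside_def intro: exI[of _ "int _"])
  qed
  have "conf T 0 0 FullRow \<longleftrightarrow>
      (\<exists>s. int s < m \<and> \<not> conf (T - s) 0 (int s) SomeZeroRight)"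
    using assms(1,2) le_T by (auto simp: conf_FullRow inside_def)
  also have "\<dots> \<longleftrightarrow> (\<exists>s. int s < m \<and> (\<forall>x. 0 \<le> x \<and> x < n \<longrightarrow> w x (int s)))"
    using row by blast
  also have "\<dots> \<longleftrightarrow> full_row"
    unfolding full_row_def by (metis nonneg_int_cases of_nat_0_le_iff)
  finally show ?thesis .
qed

lemma EmptyRow_iff:
  assumes "1 \<le> n" "1 \<le> m" and T: "int T = n + m - 2"
  shows "conf T 0 0 EmptyRow \<longleftrightarrow> \<not> rows_nonempty"
proof -
  have le_T: "s \<le> T" if "int s < m" for s using assms that by linarith
  have row: "conf (T - s) 0 (int s) SomeOneRight \<longleftrightarrow> (\<exists>x. w x (int s))"
    if "int s < m" for s
  proof -
    have "\<exists>r\<le>T - s. w (int r) (int s)" if "w x (int s)" for x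
      using that T \<open>int s < m\<close> w_inside[OF that]
      by (intro exI[of _ "nat x"]) (auto simp: inside_def)
    moreover have "inside n m 0 (int s)" using that assms by (auto simp: inside_def)
    ultimately show ?thesis by (auto simp: conf_SomeOneRight)
  qed
  have "conf T 0 0 EmptyRow \<longleftrightarrow>
      (\<exists>s. int s < m \<and> \<not> conf (T - s) 0 (int s) SomeOneRight)"
    using assms(1,2) le_T by (auto simp: conf_EmptyRow inside_def)
  also have "\<dots> \<longleftrightarrow> (\<exists>s. int s < m \<and> \<not> (\<exists>x. w x (int s)))"
    using row by blast
  also have "\<dots> \<longleftrightarrow> \<not> rows_nonempty"
    unfolding rows_nonempty_def by (metis nonneg_int_cases of_nat_0_le_iff)
  finally show ?thesis .
qed

end

section \<open>Encoding the states and assembling the recognizer\<close>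

definition accepting :: "state \<Rightarrow> bool" where
  "accepting q \<longleftrightarrow> \<not> q Error \<and> q FullRow \<and> \<not> q EmptyRow"

lemma (in picture) accepting_iff:
  assumes "1 \<le> n" "1 \<le> m" "int T = n + m - 2"
  shows "accepting (conf T 0 0) \<longleftrightarrow> l_convex ones \<and> full_row \<and> rows_nonempty"
  using FullRow_iff[OF assms] EmptyRow_iff[OF assms] no_error l_convex_if_no_error[OF _ assms(3)]
  unfolding accepting_def by blast

text \<open>States have to be natural numbers with inputs 0 and 1. Shifting an injection by 2 frees
  these codes for \<open>init False\<close> and \<open>init True\<close>.\<close>

lemma ex_encoding_nat:
  fixes a b :: "'a :: finite"
  assumes "a \<noteq> b"
  shows "\<exists>enc :: 'a \<Rightarrow> nat. inj enc \<and> enc a = 0 \<and> enc b = 1"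
proof -
  obtain g :: "'a \<Rightarrow> nat" where g: "inj g"
    using finite_imp_inj_to_nat_seg[of "UNIV :: 'a set"] by auto
  have "inj (\<lambda>z. if z = a then 0 else if z = b then 1 else g z + 2)"
    using g by (auto simp: inj_def)
  with assms show ?thesis
    by (intro exI[of _ "\<lambda>z. if z = a then 0 else if z = b then 1 else g z + 2"]) auto
qed

theorem theorem1:
  shows "\<exists>(Q :: nat set) (\<delta> :: (cell \<Rightarrow> nat) \<Rightarrow> nat) (q0 :: nat) (Qa :: nat set).
     finite Q \<and> {0, 1} \<subseteq> Q \<and> q0 \<in> Q - {0, 1} \<and> Qa \<subseteq> Q \<and>
     (\<forall>f. (\<forall>d\<in>vonNeumann. f d \<in> Q) \<longrightarrow>
          \<delta> (\<lambda>d. if d \<in> vonNeumann then f d else undefined) \<in> Q) \<and>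
     \<delta> (\<lambda>d. if d \<in> vonNeumann then q0 else undefined) = q0 \<and>
     (\<forall>n m (p :: nat \<Rightarrow> nat \<Rightarrow> nat). 1 \<le> n \<longrightarrow> 1 \<le> m \<longrightarrow>
        (\<forall>x<n. \<forall>y<m. p x y \<in> {0, 1}) \<longrightarrow>
        (((ca_global vonNeumann \<delta> ^^ (n + m - 2)) (pic_config n m p q0) (0, 0) \<in> Qa)
          \<longleftrightarrow> L_Lconvex n m p))"
proof -
  have "init False One \<noteq> init True One" by (simp add: init_def)
  hence "init False \<noteq> init True" by metis
  from ex_encoding_nat[OF this] obtain enc :: "state \<Rightarrow> nat"
    where inj: "inj enc" and enc01: "enc (init False) = 0" "enc (init True) = 1" by blast
  define dec where "dec = inv enc"
  have dec [simp]: "dec (enc s) = s" for s using inj by (simp add: dec_def)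
  define \<delta> :: "(cell \<Rightarrow> nat) \<Rightarrow> nat" where
    "\<delta> f = enc (step (dec (f (0, 0))) (dec (f (1, 0))) (dec (f (0, 1))) (dec (f (0, -1))))" for f
  have vN [simp]: "(0, 0) \<in> vonNeumann" "(1, 0) \<in> vonNeumann" "(0, 1) \<in> vonNeumann"
    "(0, -1) \<in> vonNeumann" by (auto simp: vonNeumann_def)
  have "outer Inside \<noteq> init b Inside" for b by (simp add: init_def outer_def)
  hence "outer \<noteq> init b" for b by metis
  hence q0: "enc outer \<notin> {0, 1}" using inj enc01 by (metis injD empty_iff insert_iff)
  have rec: "(ca_global vonNeumann \<delta> ^^ (n + m - 2)) (pic_config n m p (enc outer)) (0, 0)
      \<in> enc ` {q. accepting q} \<longleftrightarrow> L_Lconvex n m p"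
    if nm: "1 \<le> n" "1 \<le> m" and p: "\<forall>x<n. \<forall>y<m. p x y \<in> {0, 1}" for n m and p :: "nat \<Rightarrow> nat \<Rightarrow> nat"
  proof -
    define w where "w x y \<longleftrightarrow> inside (int n) (int m) x y \<and> p (nat x) (nat y) = 1" for x y
    interpret picture "int n" "int m" w by unfold_locales (simp add: w_def)
    have "(ca_global vonNeumann \<delta> ^^ t) (pic_config n m p (enc outer)) (x, y) = enc (conf t x y)"
      for t x y
    proof (induction t arbitrary: x y)
      case 0
      have "p (nat x) (nat y) = 0 \<or> p (nat x) (nat y) = 1" if "inside (int n) (int m) x y"
        using that p[rule_format, of "nat x" "nat y"] by (auto simp: inside_def)
      then show ?case
        unfolding conf.simps pic_config_def using enc01 by (auto simp: w_def inside_def)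
    next
      case (Suc t)
      then show ?case by (simp add: ca_global_def \<delta>_def)
    qed
    hence "?thesis \<longleftrightarrow> (accepting (conf (n + m - 2) 0 0) \<longleftrightarrow> L_Lconvex n m p)"
      using inj by (simp add: inj_image_mem_iff)
    \<comment> \<open>As \<open>n\<close> and \<open>m\<close> are positive, the subtraction of
      natural numbers is exact.\<close>
    moreover have "accepting (conf (n + m - 2) 0 0) \<longleftrightarrow> L_Lconvex n m p"
      unfolding L_Lconvex_iff[OF nm p w_def picture_axioms]
      using nm by (intro accepting_iff) auto
    ultimately show ?thesis by blast
  qed
  have quiescent: "\<delta> (\<lambda>d. if d \<in> vonNeumann then enc outer else undefined) = enc outer"
    by (auto simp: \<delta>_def step_def outer_def intro!: arg_cong[of _ _ enc])
  show ?thesis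
  proof (rule exI[of _ "range enc"], rule exI[of _ \<delta>], rule exI[of _ "enc outer"],
      rule exI[of _ "enc ` {q. accepting q}"], intro conjI)
    show "{0, 1} \<subseteq> range enc" using enc01 by (metis empty_subsetI insert_subset rangeI)
    show "finite (range enc)" by simp
    show "enc outer \<in> range enc - {0, 1}" using q0 by blast
    show "enc ` {q. accepting q} \<subseteq> range enc" by blast
    show "\<forall>f. (\<forall>d\<in>vonNeumann. f d \<in> range enc) \<longrightarrow>
        \<delta> (\<lambda>d. if d \<in> vonNeumann then f d else undefined) \<in> range enc"
      by (simp add: \<delta>_def)
  qed (use rec quiescent in blast)+
qed

end
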